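(* For every massive binary antichain $\mathcal U$ (with masses $m_X>0$, $X\in\mathcal U$) and every non-negative function $\omega$ on the nodes of the binary tree, $$\max\Big\{W(H): H\subseteq\tbinom{\mathcal U}{2}\text{ is triangle-free}\Big\}\ \le\ \max_{\chi:\mathcal U\to\{0,1\}}\ \sum_{\{X,Y\}\subseteq\mathcal U,\ \chi(X)\ne\chi(Y)}W(XY).$$
   Context: The binary tree is the rooted tree whose nodes are the finite $0/1$ words, with $P$ an ancestor of $X$ when $P$ is a prefix of $X$. An antichain is a set of nodes none of which is an ancestor of another. A massive binary antichain is a finite antichain $\mathcal U$ of binary-tree nodes together with positive real masses $m_X$ for $X\in\mathcal U$. For $X,Y\in\mathcal U$, $X\wedge Y$ is their least common ancestor (longest common prefix). Given a non-negative real function $\omega$ on nodes, the weight of a pair of distinct elements $X,Y\in\mathcal U$ is $W(XY)=m_Xm_Y\,\omega_{X\wedge Y}$, and for a graph $H$ on vertex set $\mathcal U$, $W(H)=\sum_{XY\in E(H)}W(XY)$. The sum on the right of the claim is over unordered pairs. *)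

theory Defs
  imports Complex_Main "HOL-Library.Sublist" "HOL-Library.FuncSet" "HOL-Library.Ramsey"
begin

type_synonym node = "bool list"

(* Distinct elements of an antichain are prefix-incomparable: this is the library's parallel. *)
definition massive_binary_antichain :: "node set \<Rightarrow> (node \<Rightarrow> real) \<Rightarrow> bool" where
  "massive_binary_antichain U m \<longleftrightarrow>
     finite U \<and> pairwise (\<parallel>) U \<and> (\<forall>X\<in>U. m X > 0)"

(* Unordered pairs are represented as two-element sets, so that the weight is manifestly
   symmetric; pair_weight_doubleton gives the expected form. *)
definition pair_weight :: "(node \<Rightarrow> real) \<Rightarrow> (node \<Rightarrow> real) \<Rightarrow> node set \<Rightarrow> real" where
  "pair_weight m \<omega> e = (\<Prod>X\<in>e. m X) * \<omega> (Longest_common_prefix e)"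

lemma Longest_common_prefix_doubleton:
  "Longest_common_prefix {X, Y} = longest_common_prefix X Y"
  by (rule Longest_common_prefix_eq)
    (auto simp: longest_common_prefix_prefix1 longest_common_prefix_prefix2
      intro: prefix_length_le longest_common_prefix_max_prefix)

lemma pair_weight_doubleton:
  assumes "X \<noteq> Y"
  shows "pair_weight m \<omega> {X, Y} = m X * m Y * \<omega> (longest_common_prefix X Y)"
  using assms by (simp add: pair_weight_def Longest_common_prefix_doubleton)

definition graph_weight :: "(node \<Rightarrow> real) \<Rightarrow> (node \<Rightarrow> real) \<Rightarrow> node set set \<Rightarrow> real" where
  "graph_weight m \<omega> H = (\<Sum>e\<in>H. pair_weight m \<omega> e)"

definition triangle_free :: "'a set set \<Rightarrow> bool" where
  "triangle_free H \<longleftrightarrow>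
     \<not> (\<exists>X Y Z. X \<noteq> Y \<and> Y \<noteq> Z \<and> X \<noteq> Z \<and> {X, Y} \<in> H \<and> {Y, Z} \<in> H \<and> {X, Z} \<in> H)"

definition triangle_free_graphs :: "'a set \<Rightarrow> 'a set set set" where
  "triangle_free_graphs U = {H. H \<subseteq> nsets U 2 \<and> triangle_free H}"

definition cut_weight ::
  "(node \<Rightarrow> real) \<Rightarrow> (node \<Rightarrow> real) \<Rightarrow> node set \<Rightarrow> (node \<Rightarrow> nat) \<Rightarrow> real" where
  "cut_weight m \<omega> U \<chi> =
     (\<Sum>e \<in> {{X, Y} | X Y. X \<in> U \<and> Y \<in> U \<and> \<chi> X \<noteq> \<chi> Y}. pair_weight m \<omega> e)"

(* Both index sets below are finite and nonempty, so the Max over them is a genuine maximum. *)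

lemma finite_triangle_free_graphs: "finite U \<Longrightarrow> finite (triangle_free_graphs U)"
  unfolding triangle_free_graphs_def
  by (rule finite_subset[of _ "Pow (nsets U 2)"]) (auto intro: finite_imp_finite_nsets)

lemma triangle_free_graphs_nonempty: "triangle_free_graphs U \<noteq> {}"
  by (auto simp: triangle_free_graphs_def triangle_free_def)

lemma finite_colourings: "finite U \<Longrightarrow> finite (U \<rightarrow>\<^sub>E {0, 1::nat})"
  by (simp add: finite_PiE)

lemma colourings_nonempty: "(U \<rightarrow>\<^sub>E {0, 1::nat}) \<noteq> {}"
  by (simp add: PiE_eq_empty_iff)

end

theory Submission
  imports Defs
begin

text \<open>
  A subtree of the binary tree meets the rest of the tree in a simple way: from a vertex outside of it,
  all of its leaves are seen with the same \<open>\<omega>\<close>. This suggests induction on the tree, where a node \<open>P\<close>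
  joins its two subtrees \<open>L\<close> and \<open>R\<close> by the constant weight \<open>\<gamma> = \<omega> P\<close>. A cut of \<open>L \<union> R\<close> is easy to
  evaluate. If \<open>X\<close> and \<open>Y\<close> are the biases of its restrictions to \<open>L\<close> and \<open>R\<close> (the mass of one colour
  minus the mass of the other), then the cross weight is \<open>\<gamma> * (sum m L * sum m R - X * Y) / 2\<close>.

  The inequality alone is too weak for the induction, since the edges between \<open>L\<close> and \<open>R\<close> must be
  charged to something. The stronger statement \<open>cut_dominated\<close> adds a potential: if \<open>h \<le> s\<close> with \<open>0 \<le> s\<close>
  and \<open>h x + h y \<le> 0\<close> on every edge, then the weight of the graph plus \<open>\<Sum> m x * h x\<close> is at most the
  weight of some cut plus \<open>s\<close> times its bias. Triangle-freeness enters because adjacent vertices have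
  disjoint neighbourhoods on the other side, so that the share of an endpoint in the cross edges,
  measured relative to one half, is a potential of this kind. Conversely, a neighbourhood is
  an independent set, so \<open>1\<close> on it and \<open>- 1\<close> elsewhere is such a potential, too.

  The step \<open>cut_dominated_join\<close> uses both observations in turn: the cross edges become a potential on
  \<open>L\<close>, whose maximum is attained at some \<open>x0\<close>, and the resulting error is paid by a multiple of the
  potential on \<open>R\<close> that belongs to the neighbourhood of \<open>x0\<close>. The multiple is \<open>\<gamma> * X\<close>, where \<open>X\<close> is the
  bias that \<open>L\<close> has obtained, and so the terms in the mass of the neighbourhood cancel. The theorem is
  the case \<open>h = 0\<close>, \<open>s = 0\<close>.

  All weights are sums over ordered pairs, which count each edge twice; this removes the factor
  one half from the cross weight.
\<close>

section \<open>Weights over ordered pairs\<close>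

definition ordered_weight ::
  "('a \<Rightarrow> real) \<Rightarrow> ('a \<Rightarrow> 'a \<Rightarrow> real) \<Rightarrow> 'a set \<Rightarrow> ('a \<Rightarrow> 'a \<Rightarrow> bool) \<Rightarrow> real" where
  "ordered_weight m w U E = (\<Sum>x\<in>U. \<Sum>y\<in>U. if E x y then m x * m y * w x y else 0)"

text \<open>The three vertices need not be distinct here, so such a relation is irreflexive as well.\<close>

definition triangle_free_rel :: "('a \<Rightarrow> 'a \<Rightarrow> bool) \<Rightarrow> bool" where
  "triangle_free_rel E \<longleftrightarrow> symp E \<and> (\<forall>x y z. E x y \<longrightarrow> E y z \<longrightarrow> \<not> E x z)"

definition bias :: "('a \<Rightarrow> real) \<Rightarrow> 'a set \<Rightarrow> ('a \<Rightarrow> bool) \<Rightarrow> real" where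
  "bias m U \<chi> = (\<Sum>x\<in>U. m x * (if \<chi> x then 1 else - 1))"

lemma ordered_weight_cong:
  assumes "\<And>x y. x \<in> U \<Longrightarrow> y \<in> U \<Longrightarrow> E x y = E' x y"
  shows "ordered_weight m w U E = ordered_weight m w U E'"
  unfolding ordered_weight_def using assms by (intro sum.cong) auto

lemma bias_flip: "bias m U (\<lambda>x. \<not> \<chi> x) = - bias m U \<chi>"
  unfolding bias_def sum_negf[symmetric] by (rule sum.cong) auto

section \<open>The strengthened inequality\<close>

text \<open>
  The function \<open>h\<close> stands for the edges that leave \<open>U\<close> in a larger tree: up to scaling and a shift,
  \<open>h x\<close> is the mass of the outside neighbours of \<open>x\<close>. Adjacent vertices have disjoint outside
  neighbourhoods, and the shift is by half of the outside mass, so this disjointness becomes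
  \<open>h x + h y \<le> 0\<close>. On the cut side the outside is replaced by one vertex seen only by the class
  \<open>{x. \<chi> x}\<close>, which after the same shift contributes \<open>s\<close> times the bias.
\<close>

definition cut_dominated :: "('a \<Rightarrow> real) \<Rightarrow> ('a \<Rightarrow> 'a \<Rightarrow> real) \<Rightarrow> 'a set \<Rightarrow> bool" where
  "cut_dominated m w U \<longleftrightarrow>
     (\<forall>E h s. triangle_free_rel E \<longrightarrow> 0 \<le> s \<longrightarrow> (\<forall>x\<in>U. h x \<le> s) \<longrightarrow>
        (\<forall>x\<in>U. \<forall>y\<in>U. E x y \<longrightarrow> h x + h y \<le> 0) \<longrightarrow>
        (\<exists>\<chi>. ordered_weight m w U E + (\<Sum>x\<in>U. m x * h x)
               \<le> ordered_weight m w U (\<lambda>x y. \<chi> x \<noteq> \<chi> y) + s * bias m U \<chi>))"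

text \<open>
  Exchanging the two colours keeps the cut and negates the bias, so for \<open>s \<ge> 0\<close> the bias may be taken
  non-negative.
\<close>

lemma cut_dominatedE:
  assumes "cut_dominated m w U" "triangle_free_rel E" "0 \<le> s" "\<And>x. x \<in> U \<Longrightarrow> h x \<le> s"
    and "\<And>x y. x \<in> U \<Longrightarrow> y \<in> U \<Longrightarrow> E x y \<Longrightarrow> h x + h y \<le> 0"
  obtains \<chi> where "0 \<le> bias m U \<chi>"
    and "ordered_weight m w U E + (\<Sum>x\<in>U. m x * h x)
           \<le> ordered_weight m w U (\<lambda>x y. \<chi> x \<noteq> \<chi> y) + s * bias m U \<chi>"
proof -
  obtain \<chi> where \<chi>: "ordered_weight m w U E + (\<Sum>x\<in>U. m x * h x)
           \<le> ordered_weight m w U (\<lambda>x y. \<chi> x \<noteq> \<chi> y) + s * bias m U \<chi>"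
    using assms unfolding cut_dominated_def by blast
  show thesis
  proof (cases "0 \<le> bias m U \<chi>")
    case True
    with \<chi> that show thesis by blast
  next
    case False
    have "s * bias m U \<chi> \<le> s * bias m U (\<lambda>x. \<not> \<chi> x)"
      using False \<open>0 \<le> s\<close> unfolding bias_flip by (intro mult_left_mono) auto
    with \<chi> False show thesis
      by (intro that[of "\<lambda>x. \<not> \<chi> x"]) (auto simp: bias_flip)
  qed
qed

lemma cut_dominated_subsingleton:
  assumes "U \<subseteq> {P}" "\<And>x. x \<in> U \<Longrightarrow> 0 \<le> m x"
  shows "cut_dominated m w U"
  unfolding cut_dominated_def
proof (intro allI impI exI)
  fix E :: "'a \<Rightarrow> 'a \<Rightarrow> bool" and h :: "'a \<Rightarrow> real" and s :: real
  assume E: "triangle_free_rel E" and h: "\<forall>x\<in>U. h x \<le> s"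
  have "\<not> E P P" using E unfolding triangle_free_rel_def by blast
  then have "ordered_weight m w U E = 0"
    using assms(1) unfolding ordered_weight_def by (intro sum.neutral ballI) auto
  moreover have "(\<Sum>x\<in>U. m x * h x) \<le> s * bias m U (\<lambda>_. True)"
    unfolding bias_def sum_distrib_left using h assms(2)
    by (intro sum_mono) (simp add: mult.commute mult_right_mono)
  ultimately show "ordered_weight m w U E + (\<Sum>x\<in>U. m x * h x)
      \<le> ordered_weight m w U (\<lambda>x y. True \<noteq> True) + s * bias m U (\<lambda>_. True)"
    by (simp add: ordered_weight_def)
qed

section \<open>Joining two subtrees\<close>

lemma ordered_weight_join:
  assumes "finite L" "finite R" "L \<inter> R = {}" "symp E"
    and "\<And>x y. x \<in> L \<Longrightarrow> y \<in> R \<Longrightarrow> w x y = \<gamma> \<and> w y x = \<gamma>"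
  shows "ordered_weight m w (L \<union> R) E = ordered_weight m w L E + ordered_weight m w R E
           + 2 * \<gamma> * (\<Sum>x\<in>L. m x * (\<Sum>y\<in>R. if E x y then m y else 0))"
proof -
  let ?f = "\<lambda>x y. if E x y then m x * m y * w x y else 0"
  have LR: "(\<Sum>x\<in>L. \<Sum>y\<in>R. ?f x y) = \<gamma> * (\<Sum>x\<in>L. m x * (\<Sum>y\<in>R. if E x y then m y else 0))"
    unfolding sum_distrib_left using assms(5) by (intro sum.cong) auto
  have "(\<Sum>x\<in>R. \<Sum>y\<in>L. ?f x y) = (\<Sum>y\<in>L. \<Sum>x\<in>R. ?f x y)"
    by (rule sum.swap)
  also have "\<dots> = (\<Sum>x\<in>L. \<Sum>y\<in>R. ?f x y)"
    using assms(5) sympD[OF \<open>symp E\<close>] by (intro sum.cong refl) (auto simp: mult_ac)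
  finally show ?thesis
    using assms(1-3) LR
    by (simp add: ordered_weight_def sum.union_disjoint sum.distrib algebra_simps)
qed

text \<open>
  Between two vertices the indicator of being cut is \<open>(1 - \<epsilon>\<^sub>x \<epsilon>\<^sub>y) / 2\<close> with signs \<open>\<epsilon>\<close>; summing it over
  \<open>L \<times> R\<close> shows that a cut sees the other side only through its bias.
\<close>

lemma ordered_weight_cut_join:
  assumes "finite L" "finite R" "L \<inter> R = {}"
    and "\<And>x y. x \<in> L \<Longrightarrow> y \<in> R \<Longrightarrow> w x y = \<gamma> \<and> w y x = \<gamma>"
  shows "ordered_weight m w (L \<union> R) (\<lambda>x y. \<chi> x \<noteq> \<chi> y)
           = ordered_weight m w L (\<lambda>x y. \<chi> x \<noteq> \<chi> y) + ordered_weight m w R (\<lambda>x y. \<chi> x \<noteq> \<chi> y)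
             + \<gamma> * (sum m L * sum m R - bias m L \<chi> * bias m R \<chi>)"
proof -
  have "sum m L * sum m R - bias m L \<chi> * bias m R \<chi>
      = (\<Sum>x\<in>L. \<Sum>y\<in>R. m x * m y - (m x * (if \<chi> x then 1 else - 1)) * (m y * (if \<chi> y then 1 else - 1)))"
    unfolding bias_def by (simp only: sum_product sum_subtractf)
  also have "\<dots> = 2 * (\<Sum>x\<in>L. m x * (\<Sum>y\<in>R. if \<chi> x \<noteq> \<chi> y then m y else 0))"
    unfolding sum_distrib_left by (intro sum.cong) auto
  finally show ?thesis
    using ordered_weight_join[OF assms(1-3) _ assms(4), where E = "\<lambda>x y. \<chi> x \<noteq> \<chi> y"]
    by (simp add: symp_def mult.assoc)
qed

lemma bias_join:
  assumes "finite L" "finite R" "L \<inter> R = {}"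
  shows "bias m (L \<union> R) \<chi> = bias m L \<chi> + bias m R \<chi>"
  using assms by (simp add: bias_def sum.union_disjoint)

lemma glue_colourings:
  assumes "finite L" "finite R" "L \<inter> R = {}"
    and "\<And>x y. x \<in> L \<Longrightarrow> y \<in> R \<Longrightarrow> w x y = \<gamma> \<and> w y x = \<gamma>"
  obtains \<chi> where
    "ordered_weight m w (L \<union> R) (\<lambda>x y. \<chi> x \<noteq> \<chi> y)
       = ordered_weight m w L (\<lambda>x y. \<alpha> x \<noteq> \<alpha> y) + ordered_weight m w R (\<lambda>x y. \<beta> x \<noteq> \<beta> y)
         + \<gamma> * (sum m L * sum m R - bias m L \<alpha> * bias m R \<beta>)"
    "bias m (L \<union> R) \<chi> = bias m L \<alpha> + bias m R \<beta>"
proof -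
  define \<chi> where "\<chi> = (\<lambda>x. if x \<in> L then \<alpha> x else \<beta> x)"
  have R: "x \<notin> L" if "x \<in> R" for x using assms(3) that by auto
  have "ordered_weight m w L (\<lambda>x y. \<chi> x \<noteq> \<chi> y) = ordered_weight m w L (\<lambda>x y. \<alpha> x \<noteq> \<alpha> y)"
    "ordered_weight m w R (\<lambda>x y. \<chi> x \<noteq> \<chi> y) = ordered_weight m w R (\<lambda>x y. \<beta> x \<noteq> \<beta> y)"
    by (rule ordered_weight_cong; simp add: \<chi>_def R)+
  moreover have "bias m L \<chi> = bias m L \<alpha>" "bias m R \<chi> = bias m R \<beta>"
    unfolding bias_def by (rule sum.cong; simp add: \<chi>_def R)+
  ultimately show thesis
    using that[of \<chi>] ordered_weight_cut_join[OF assms, where m = m and \<chi> = \<chi>]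
      bias_join[OF assms(1-3), where m = m and \<chi> = \<chi>] by simp
qed

text \<open>
  Two colourings with biases \<open>X\<close> and \<open>Y\<close> can be glued as they are, or with either one flipped. The
  first choice aligns the biases and pays \<open>\<gamma> * X * Y\<close>, the other two subtract the biases and gain that
  amount. It is enough to reach the better of these outcomes.
\<close>

lemma glued_value:
  assumes "finite L" "finite R" "L \<inter> R = {}"
    and "\<And>x y. x \<in> L \<Longrightarrow> y \<in> R \<Longrightarrow> w x y = \<gamma> \<and> w y x = \<gamma>"
    and bound: "v \<le> s * (X + Y) - \<gamma> * X * Y \<or> v \<le> s * \<bar>X - Y\<bar> + \<gamma> * X * Y"
    and X: "X = bias m L \<alpha>" and Y: "Y = bias m R \<beta>"
  shows "\<exists>\<chi>. ordered_weight m w L (\<lambda>x y. \<alpha> x \<noteq> \<alpha> y) + ordered_weight m w R (\<lambda>x y. \<beta> x \<noteq> \<beta> y)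
            + \<gamma> * (sum m L * sum m R) + v
          \<le> ordered_weight m w (L \<union> R) (\<lambda>x y. \<chi> x \<noteq> \<chi> y) + s * bias m (L \<union> R) \<chi>"
proof -
  note glue = glue_colourings[OF assms(1-4), where m = m]
  consider "v \<le> s * (X + Y) - \<gamma> * X * Y" | "v \<le> s * (X - Y) + \<gamma> * X * Y"
    | "v \<le> s * (Y - X) + \<gamma> * X * Y"
    using bound by (cases "X \<ge> Y") auto
  then show ?thesis
  proof cases
    case 1
    obtain \<chi> where \<chi>:
      "ordered_weight m w (L \<union> R) (\<lambda>x y. \<chi> x \<noteq> \<chi> y)
         = ordered_weight m w L (\<lambda>x y. \<alpha> x \<noteq> \<alpha> y) + ordered_weight m w R (\<lambda>x y. \<beta> x \<noteq> \<beta> y)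
           + \<gamma> * (sum m L * sum m R - bias m L \<alpha> * bias m R \<beta>)"
      "bias m (L \<union> R) \<chi> = bias m L \<alpha> + bias m R \<beta>"
      by (rule glue[where \<alpha> = \<alpha> and \<beta> = \<beta>])
    from 1 show ?thesis unfolding X Y
      by (intro exI[of _ \<chi>], unfold \<chi> bias_flip) (simp add: algebra_simps)
  next
    case 2
    obtain \<chi> where \<chi>:
      "ordered_weight m w (L \<union> R) (\<lambda>x y. \<chi> x \<noteq> \<chi> y)
         = ordered_weight m w L (\<lambda>x y. \<alpha> x \<noteq> \<alpha> y) + ordered_weight m w R (\<lambda>x y. (\<not> \<beta> x) \<noteq> (\<not> \<beta> y))
           + \<gamma> * (sum m L * sum m R - bias m L \<alpha> * bias m R (\<lambda>x. \<not> \<beta> x))"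
      "bias m (L \<union> R) \<chi> = bias m L \<alpha> + bias m R (\<lambda>x. \<not> \<beta> x)"
      by (rule glue[where \<alpha> = \<alpha> and \<beta> = "\<lambda>x. \<not> \<beta> x"])
    from 2 show ?thesis unfolding X Y
      by (intro exI[of _ \<chi>], unfold \<chi> bias_flip) (simp add: algebra_simps)
  next
    case 3
    obtain \<chi> where \<chi>:
      "ordered_weight m w (L \<union> R) (\<lambda>x y. \<chi> x \<noteq> \<chi> y)
         = ordered_weight m w L (\<lambda>x y. (\<not> \<alpha> x) \<noteq> (\<not> \<alpha> y)) + ordered_weight m w R (\<lambda>x y. \<beta> x \<noteq> \<beta> y)
           + \<gamma> * (sum m L * sum m R - bias m L (\<lambda>x. \<not> \<alpha> x) * bias m R \<beta>)"
      "bias m (L \<union> R) \<chi> = bias m L (\<lambda>x. \<not> \<alpha> x) + bias m R \<beta>"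
      by (rule glue[where \<alpha> = "\<lambda>x. \<not> \<alpha> x" and \<beta> = \<beta>])
    from 3 show ?thesis unfolding X Y
      by (intro exI[of _ \<chi>], unfold \<chi> bias_flip) (simp add: algebra_simps)
  qed
qed

lemma triangle_free_neighbourhoods:
  assumes "triangle_free_rel E" "E x x'" "\<And>y. y \<in> R \<Longrightarrow> 0 \<le> m y"
  shows "(\<Sum>y\<in>R. if E x y then m y else 0) + (\<Sum>y\<in>R. if E x' y then m y else 0) \<le> (sum m R :: real)"
  unfolding sum.distrib[symmetric]
  using assms by (intro sum_mono) (auto simp: triangle_free_rel_def)

text \<open>
  This is the induction step. Seen from \<open>L\<close>, the cross edges add \<open>\<gamma> * (2 * d x - sum m R)\<close> to the
  potential \<open>h x\<close>, where \<open>d x\<close> is the mass of the neighbours of \<open>x\<close> in \<open>R\<close>. Let \<open>x0\<close> maximise the new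
  potential \<open>h'\<close>. If the maximum is positive, it serves as the slope in \<open>L\<close> and yields a colouring of
  some bias \<open>X \<ge> 0\<close>, at the price of an excess \<open>h' x0 * X\<close>. This excess is linear in the mass
  of the neighbourhood of \<open>x0\<close> in \<open>R\<close>. That neighbourhood is independent, so the excess can be absorbed
  into the potential on \<open>R\<close>, by adding \<open>\<gamma> * X\<close> on it and subtracting \<open>\<gamma> * X\<close> elsewhere. The
  hypothesis for \<open>R\<close> then returns a bias \<open>Y \<ge> 0\<close>, and one of the gluings of the two colourings suffices.
\<close>

lemma cut_dominated_join:
  fixes m :: "'a \<Rightarrow> real"
  assumes fin: "finite L" "finite R" "L \<inter> R = {}"
    and w: "\<And>x y. x \<in> L \<Longrightarrow> y \<in> R \<Longrightarrow> w x y = \<gamma> \<and> w y x = \<gamma>" and \<gamma>: "0 \<le> \<gamma>"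
    and m: "\<And>x. x \<in> L \<union> R \<Longrightarrow> 0 \<le> m x"
    and L: "cut_dominated m w L" and R: "cut_dominated m w R"
  shows "cut_dominated m w (L \<union> R)"
  unfolding cut_dominated_def
proof (intro allI impI)
  fix E :: "'a \<Rightarrow> 'a \<Rightarrow> bool" and h :: "'a \<Rightarrow> real" and s :: real
  assume E: "triangle_free_rel E" and s: "0 \<le> s" and hs: "\<forall>x\<in>L \<union> R. h x \<le> s"
    and hE: "\<forall>x\<in>L \<union> R. \<forall>y\<in>L \<union> R. E x y \<longrightarrow> h x + h y \<le> 0"
  let ?D = "ordered_weight m w" and ?cut = "\<lambda>\<chi> x y. \<chi> x \<noteq> (\<chi> y :: bool)"
  define d where "d x = (\<Sum>y\<in>R. if E x y then m y else 0)" for x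
  define h' where "h' x = h x + \<gamma> * (2 * d x - sum m R)" for x
  have total: "?D (L \<union> R) E + (\<Sum>x\<in>L \<union> R. m x * h x)
      = ?D L E + (\<Sum>x\<in>L. m x * h' x) + (?D R E + (\<Sum>x\<in>R. m x * h x)) + \<gamma> * (sum m L * sum m R)"
  proof -
    have "(\<Sum>x\<in>L. m x * h' x)
        = (\<Sum>x\<in>L. m x * h x) + 2 * \<gamma> * (\<Sum>x\<in>L. m x * d x) - \<gamma> * (sum m L * sum m R)"
      by (simp add: h'_def distrib_left right_diff_distrib sum.distrib sum_subtractf
          sum_distrib_left sum_distrib_right sum.swap[of _ R L] mult_ac)
    then show ?thesis
      using ordered_weight_join[OF fin _ w, where E = E and m = m] E fin
      by (simp add: triangle_free_rel_def d_def sum.union_disjoint)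
  qed
  have h'E: "h' x + h' x' \<le> 0" if "x \<in> L" "x' \<in> L" "E x x'" for x x'
  proof -
    have "d x + d x' \<le> sum m R"
      unfolding d_def by (rule triangle_free_neighbourhoods[OF E that(3)]) (simp add: m)
    then have "\<gamma> * (2 * (d x + d x') - 2 * sum m R) \<le> 0"
      using \<gamma> by (simp add: mult_nonneg_nonpos)
    moreover have "h x + h x' \<le> 0" using hE that by auto
    ultimately show ?thesis by (simp add: h'_def algebra_simps)
  qed
  show "\<exists>\<chi>. ?D (L \<union> R) E + (\<Sum>x\<in>L \<union> R. m x * h x)
           \<le> ?D (L \<union> R) (?cut \<chi>) + s * bias m (L \<union> R) \<chi>"
  proof (cases "\<forall>x\<in>L. h' x \<le> 0")
    case True
    obtain \<alpha> where \<alpha>: "0 \<le> bias m L \<alpha>"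
      "?D L E + (\<Sum>x\<in>L. m x * h' x) \<le> ?D L (?cut \<alpha>) + 0 * bias m L \<alpha>"
      by (rule cut_dominatedE[OF L E order_refl, of h']) (use True h'E in auto)
    obtain \<beta> where \<beta>: "0 \<le> bias m R \<beta>"
      "?D R E + (\<Sum>x\<in>R. m x * h x) \<le> ?D R (?cut \<beta>) + s * bias m R \<beta>"
      by (rule cut_dominatedE[OF R E s, of h]) (use hs hE in auto)
    \<comment> \<open>The values of the aligned and the opposed gluing add up to at least \<open>2 * s * Y\<close>, so one of them
      is at least \<open>s * Y\<close>, whatever \<open>X\<close> is.\<close>
    define X Y where "X = bias m L \<alpha>" and "Y = bias m R \<beta>"
    have "s * (Y - X) \<le> s * \<bar>X - Y\<bar>" using s by (intro mult_left_mono) auto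
    then have "s * Y \<le> s * (X + Y) - \<gamma> * X * Y \<or> s * Y \<le> s * \<bar>X - Y\<bar> + \<gamma> * X * Y"
      by (auto simp: algebra_simps)
    from glued_value[where w = w, OF fin w this X_def Y_def] obtain \<chi> where
      "?D L (?cut \<alpha>) + ?D R (?cut \<beta>) + \<gamma> * (sum m L * sum m R) + s * Y
          \<le> ?D (L \<union> R) (?cut \<chi>) + s * bias m (L \<union> R) \<chi>" by blast
    with \<alpha> \<beta> total show ?thesis by (intro exI[of _ \<chi>]) (simp add: Y_def)
  next
    case False
    have "Max (h' ` L) \<in> h' ` L" using False fin(1) by (intro Max_in) auto
    then obtain x0 where x0: "x0 \<in> L" "Max (h' ` L) = h' x0" by blast
    have max: "h' x \<le> h' x0" if "x \<in> L" for x
      using Max_ge[of "h' ` L" "h' x"] fin(1) that by (simp add: x0(2))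
    have pos: "0 \<le> h' x0" using False max by fastforce
    obtain \<alpha> where \<alpha>: "0 \<le> bias m L \<alpha>"
      "?D L E + (\<Sum>x\<in>L. m x * h' x) \<le> ?D L (?cut \<alpha>) + h' x0 * bias m L \<alpha>"
      by (rule cut_dominatedE[OF L E pos, of h']) (use max h'E in auto)
    define X where "X = bias m L \<alpha>"
    define \<tau> where "\<tau> = \<gamma> * X"
    \<comment> \<open>The neighbours of \<open>x0\<close> in \<open>R\<close> have potential at most \<open>min s (- h x0)\<close>, and the other vertices
      at most \<open>s\<close>. After adding \<open>\<tau> * k\<close> this gives the slope \<open>\<sigma>\<close>. Below \<open>- s\<close>, the value of
      \<open>h x0\<close> would not improve the first bound, hence the truncation in \<open>\<theta>\<close>.\<close>
    define \<theta> where "\<theta> = max (h x0) (- s)"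
    define k where "k y = (if E x0 y then 1 else - 1 :: real)" for y
    define \<sigma> where "\<sigma> = max (\<tau> - \<theta>) (s - \<tau>)"
    have \<tau>: "0 \<le> \<tau>" using \<gamma> \<alpha>(1) by (simp add: \<tau>_def X_def)
    have \<theta>: "h x0 \<le> \<theta>" "- s \<le> \<theta>" "\<theta> \<le> s" using hs x0(1) s by (auto simp: \<theta>_def)
    have \<sigma>: "0 \<le> \<sigma>" using \<theta> by (auto simp: \<sigma>_def max_def)
    have slope: "h y + \<tau> * k y \<le> \<sigma>" if "y \<in> R" for y
    proof -
      have "h y \<le> s" "E x0 y \<Longrightarrow> h x0 + h y \<le> 0" using hs hE x0(1) that by auto
      then show ?thesis by (auto simp: k_def \<sigma>_def \<theta>_def max_def)
    qed
    have edges: "h y + \<tau> * k y + (h y' + \<tau> * k y') \<le> 0" if "y \<in> R" "y' \<in> R" "E y y'" for y y'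
    proof -
      have "k y + k y' \<le> 0"
        using E that(3) unfolding triangle_free_rel_def k_def by (auto dest: sympD)
      then have "\<tau> * (k y + k y') \<le> 0" using \<tau> by (simp add: mult_nonneg_nonpos)
      moreover have "h y + h y' \<le> 0" using hE that by auto
      ultimately show ?thesis by (simp add: algebra_simps)
    qed
    obtain \<beta> where \<beta>: "0 \<le> bias m R \<beta>"
      "?D R E + (\<Sum>y\<in>R. m y * (h y + \<tau> * k y)) \<le> ?D R (?cut \<beta>) + \<sigma> * bias m R \<beta>"
      by (rule cut_dominatedE[OF R E \<sigma>, of "\<lambda>y. h y + \<tau> * k y"]) (use slope edges in auto)
    define Y where "Y = bias m R \<beta>"
    have nonneg: "0 \<le> X" "0 \<le> Y" using \<alpha> \<beta> by (auto simp: X_def Y_def)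
    have k: "(\<Sum>y\<in>R. m y * k y) = 2 * d x0 - sum m R"
      unfolding d_def k_def sum_distrib_left sum_subtractf[symmetric] by (rule sum.cong) auto
    have "(\<Sum>y\<in>R. m y * (h y + \<tau> * k y)) = (\<Sum>y\<in>R. m y * h y) + \<tau> * (\<Sum>y\<in>R. m y * k y)"
      unfolding sum_distrib_left sum.distrib[symmetric] by (rule sum.cong) (auto simp: algebra_simps)
    then have gain: "(\<Sum>y\<in>R. m y * (h y + \<tau> * k y)) = (\<Sum>y\<in>R. m y * h y) + X * (h' x0 - h x0)"
      by (simp add: k h'_def \<tau>_def)
    have hX: "h x0 * X \<le> \<theta> * X" using \<theta> nonneg by (simp add: mult_right_mono)
    \<comment> \<open>If \<open>\<sigma> = s - \<tau>\<close>, aligned biases suffice because \<open>\<theta> \<le> s\<close>. If \<open>\<sigma> = \<tau> - \<theta>\<close>, then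
      \<open>\<theta> * X + \<sigma> * Y = \<theta> * (X - Y) + \<tau> * Y\<close>, and opposed biases suffice because \<open>\<bar>\<theta>\<bar> \<le> s\<close>.\<close>
    have "\<theta> * X + \<sigma> * Y \<le> s * (X + Y) - \<gamma> * X * Y \<or> \<theta> * X + \<sigma> * Y \<le> s * \<bar>X - Y\<bar> + \<gamma> * X * Y"
    proof (cases "\<tau> - \<theta> \<le> s - \<tau>")
      case True
      have "\<theta> * X \<le> s * X" using \<theta> nonneg by (simp add: mult_right_mono)
      with True show ?thesis by (simp add: \<sigma>_def \<tau>_def max_def algebra_simps)
    next
      case False
      have "\<theta> * (X - Y) \<le> \<bar>\<theta>\<bar> * \<bar>X - Y\<bar>" by (metis abs_ge_self abs_mult)
      also have "\<dots> \<le> s * \<bar>X - Y\<bar>" using \<theta> by (intro mult_right_mono) auto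
      finally show ?thesis using False by (simp add: \<sigma>_def \<tau>_def max_def algebra_simps)
    qed
    from glued_value[where w = w, OF fin w this X_def Y_def] obtain \<chi> where
      "?D L (?cut \<alpha>) + ?D R (?cut \<beta>) + \<gamma> * (sum m L * sum m R) + (\<theta> * X + \<sigma> * Y)
          \<le> ?D (L \<union> R) (?cut \<chi>) + s * bias m (L \<union> R) \<chi>" by blast
    with \<alpha>(2) \<beta>(2) total gain hX show ?thesis
      by (intro exI[of _ \<chi>]) (simp add: X_def Y_def algebra_simps)
  qed
qed

section \<open>Antichains in the binary tree\<close>

lemma longest_common_prefix_branch:
  assumes "prefix (P @ [a]) X" "prefix (P @ [b]) Y" "a \<noteq> b"
  shows "longest_common_prefix X Y = P"
  using assms by (induction P arbitrary: X Y) (auto simp: prefix_def)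

text \<open>
  The induction is on the height of \<open>U\<close> above a common prefix \<open>P\<close>. All pairs that separate at \<open>P\<close> have the
  same \<open>\<omega>\<close>, so the two subtrees below \<open>P\<close> are joined with a constant weight.
\<close>

lemma cut_dominated_antichain:
  fixes U :: "node set"
  assumes "finite U" "pairwise (\<parallel>) U" "\<And>X. X \<in> U \<Longrightarrow> 0 \<le> m X" "\<And>Q. 0 \<le> \<omega> Q"
    and "\<And>X. X \<in> U \<Longrightarrow> prefix P X \<and> length X \<le> length P + n"
  shows "cut_dominated m (\<lambda>X Y. \<omega> (longest_common_prefix X Y)) U"
  using assms
proof (induction n arbitrary: P U)
  case 0
  then have "U \<subseteq> {P}" by (force simp: prefix_def)
  then show ?case by (rule cut_dominated_subsingleton) (use 0 in auto)
next
  case (Suc n)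
  show ?case
  proof (cases "P \<in> U")
    case True
    then have "U \<subseteq> {P}" using Suc.prems(2,5) unfolding pairwise_def by blast
    then show ?thesis by (rule cut_dominated_subsingleton) (use Suc.prems in auto)
  next
    case False
    define V where "V b = {X \<in> U. prefix (P @ [b]) X}" for b
    have "prefix (P @ [False]) X \<or> prefix (P @ [True]) X" if X: "X \<in> U" for X
    proof -
      obtain Z where Z: "X = P @ Z" using Suc.prems(5)[OF X] by (auto simp: prefix_def)
      with X False obtain b Z' where "Z = b # Z'" by (cases Z) auto
      with Z show ?thesis by (cases b) auto
    qed
    then have U: "U = V False \<union> V True" by (auto simp: V_def)
    have IH: "cut_dominated m (\<lambda>X Y. \<omega> (longest_common_prefix X Y)) (V b)" for b
    proof (rule Suc.IH[of "V b" "P @ [b]"])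
      show "pairwise (\<parallel>) (V b)" using Suc.prems(2) by (rule pairwise_subset) (auto simp: V_def)
    qed (use Suc.prems in \<open>auto simp: V_def\<close>)
    show ?thesis unfolding U
    proof (rule cut_dominated_join[where \<gamma> = "\<omega> P"])
      show "V False \<inter> V True = {}" by (auto simp: V_def prefix_def)
      fix X Y assume "X \<in> V False" "Y \<in> V True"
      then have "prefix (P @ [False]) X" "prefix (P @ [True]) Y" by (auto simp: V_def)
      then have "longest_common_prefix X Y = P" "longest_common_prefix Y X = P"
        by (auto intro: longest_common_prefix_branch)
      then show "\<omega> (longest_common_prefix X Y) = \<omega> P \<and> \<omega> (longest_common_prefix Y X) = \<omega> P"
        by simp
    qed (use Suc.prems IH in \<open>auto simp: V_def\<close>)
  qed
qed

section \<open>From ordered to unordered pairs\<close>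

lemma graph_weight_eq_ordered_weight:
  assumes "finite U" "H \<subseteq> nsets U 2"
  shows "2 * graph_weight m \<omega> H
    = ordered_weight m (\<lambda>X Y. \<omega> (longest_common_prefix X Y)) U (\<lambda>X Y. {X, Y} \<in> H)"
proof -
  let ?S = "{p \<in> U \<times> U. {fst p, snd p} \<in> H}"
  let ?f = "\<lambda>p. pair_weight m \<omega> {fst p, snd p}"
  have finH: "finite H" using assms by (meson finite_imp_finite_nsets finite_subset)
  have "ordered_weight m (\<lambda>X Y. \<omega> (longest_common_prefix X Y)) U (\<lambda>X Y. {X, Y} \<in> H)
      = (\<Sum>X\<in>U. \<Sum>Y\<in>U. if {X, Y} \<in> H then pair_weight m \<omega> {X, Y} else 0)"
    unfolding ordered_weight_def
  proof (intro sum.cong refl)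
    fix X Y
    have "X \<noteq> Y" if "{X, Y} \<in> H" using that assms(2) by (auto simp: nsets_def)
    then show "(if {X, Y} \<in> H then m X * m Y * \<omega> (longest_common_prefix X Y) else 0)
        = (if {X, Y} \<in> H then pair_weight m \<omega> {X, Y} else 0)"
      using pair_weight_doubleton[of X Y m \<omega>] by auto
  qed
  also have "\<dots> = sum ?f ?S"
    using assms(1) by (simp add: sum.cartesian_product sum.inter_filter case_prod_unfold)
  also have "\<dots> = (\<Sum>e\<in>H. sum ?f {p \<in> ?S. {fst p, snd p} = e})"
    using assms(1) finH by (intro sum.group[symmetric]) auto
  also have "\<dots> = (\<Sum>e\<in>H. 2 * pair_weight m \<omega> e)"
  proof (rule sum.cong[OF refl])
    fix e assume e: "e \<in> H"
    with assms(2) have "card e = 2" "e \<subseteq> U" by (auto simp: nsets_def)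
    then obtain X Y where XY: "X \<in> U" "Y \<in> U" "X \<noteq> Y" "e = {X, Y}"
      by (auto simp: card_2_iff)
    then have fibre: "{p \<in> ?S. {fst p, snd p} = e} = {(X, Y), (Y, X)}"
      using e unfolding XY(4) by (auto simp: doubleton_eq_iff insert_commute)
    show "sum ?f {p \<in> ?S. {fst p, snd p} = e} = 2 * pair_weight m \<omega> e"
      unfolding fibre using XY(3,4) by (simp add: insert_commute)
  qed
  finally show ?thesis by (simp add: graph_weight_def sum_distrib_left)
qed

theorem theorem7p2:
  fixes U :: "node set" and m \<omega> :: "node \<Rightarrow> real"
  assumes "massive_binary_antichain U m"
    and "\<And>P. \<omega> P \<ge> 0"
  shows "(MAX H \<in> triangle_free_graphs U. graph_weight m \<omega> H)
       \<le> (MAX \<chi> \<in> U \<rightarrow>\<^sub>E {0, 1}. cut_weight m \<omega> U \<chi>)"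
proof -
  have U: "finite U" "pairwise (\<parallel>) U" "\<And>X. X \<in> U \<Longrightarrow> 0 \<le> m X"
    using assms(1) by (auto simp: massive_binary_antichain_def less_imp_le)
  let ?w = "\<lambda>X Y. \<omega> (longest_common_prefix X Y)"
  have "cut_dominated m ?w U"
  proof (rule cut_dominated_antichain[OF U assms(2)])
    fix X assume "X \<in> U"
    then show "prefix [] X \<and> length X \<le> length [] + Max (length ` U)" using U(1) by simp
  qed
  have "\<exists>\<chi>\<in>U \<rightarrow>\<^sub>E {0, 1}. graph_weight m \<omega> H \<le> cut_weight m \<omega> U \<chi>"
    if "H \<in> triangle_free_graphs U" for H
  proof -
    have H: "H \<subseteq> nsets U 2" "triangle_free H" using that by (auto simp: triangle_free_graphs_def)
    have ne: "X \<noteq> Y" if "{X, Y} \<in> H" for X Y using that H(1) by (auto simp: nsets_def)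
    have "triangle_free_rel (\<lambda>X Y. {X, Y} \<in> H)"
      unfolding triangle_free_rel_def symp_def
    proof (intro conjI allI impI notI)
      fix X Y assume "{X, Y} \<in> H"
      then show "{Y, X} \<in> H" by (simp add: insert_commute)
    next
      fix X Y Z assume "{X, Y} \<in> H" "{Y, Z} \<in> H" "{X, Z} \<in> H"
      with H(2) ne show False unfolding triangle_free_def by blast
    qed
    then obtain \<chi> where "ordered_weight m ?w U (\<lambda>X Y. {X, Y} \<in> H) + (\<Sum>X\<in>U. m X * 0)
        \<le> ordered_weight m ?w U (\<lambda>X Y. \<chi> X \<noteq> \<chi> Y) + 0 * bias m U \<chi>"
      by (rule cut_dominatedE[OF \<open>cut_dominated m ?w U\<close> _ order_refl, where h = "\<lambda>_. 0"]) auto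
    then have \<chi>: "ordered_weight m ?w U (\<lambda>X Y. {X, Y} \<in> H)
        \<le> ordered_weight m ?w U (\<lambda>X Y. \<chi> X \<noteq> \<chi> Y)" by simp
    define \<xi> where "\<xi> = restrict (\<lambda>X. if \<chi> X then 1 else 0 :: nat) U"
    let ?C = "{{X, Y} | X Y. X \<in> U \<and> Y \<in> U \<and> \<xi> X \<noteq> \<xi> Y}"
    have "ordered_weight m ?w U (\<lambda>X Y. \<chi> X \<noteq> \<chi> Y) = ordered_weight m ?w U (\<lambda>X Y. {X, Y} \<in> ?C)"
      by (rule ordered_weight_cong) (auto simp: \<xi>_def doubleton_eq_iff)
    also have "\<dots> = 2 * graph_weight m \<omega> ?C"
      by (rule graph_weight_eq_ordered_weight[symmetric, OF U(1)]) (auto simp: nsets_def card_2_iff)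
    finally have "graph_weight m \<omega> H \<le> cut_weight m \<omega> U \<xi>"
      using \<chi> graph_weight_eq_ordered_weight[OF U(1) H(1), of m \<omega>]
      by (simp add: graph_weight_def cut_weight_def)
    moreover have "\<xi> \<in> U \<rightarrow>\<^sub>E {0, 1}" by (auto simp: \<xi>_def)
    ultimately show ?thesis by blast
  qed
  then have "graph_weight m \<omega> H \<le> (MAX \<chi> \<in> U \<rightarrow>\<^sub>E {0, 1}. cut_weight m \<omega> U \<chi>)"
    if "H \<in> triangle_free_graphs U" for H
    using that finite_colourings[OF U(1)] by (meson Max_ge finite_imageI imageI order_trans)
  then show ?thesis
    using finite_triangle_free_graphs[OF U(1)] triangle_free_graphs_nonempty[of U]
    by (intro Max.boundedI) auto
qed

end
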